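(* Let $\mu$ be a finite Borel measure on $\mathbb{R}^N$ and let $\mathcal{F}$ be an equicontinuous and uniformly bounded family of probability density functions on $\mathbb{R}^N$. Define $$\Psi=\{P_p:\ P_p\le\mu,\ p\in\mathcal{F}\}.$$ Then $\Psi$ is precompact under total variation.
   Context: For a probability density function $p$ on $\mathbb{R}^N$ (with respect to Lebesgue measure), $P_p$ denotes the induced probability measure $P_p(A)=\int_A p(x)\,dx$, $A\in\mathcal{B}(\mathbb{R}^N)$. For finite measures, $\nu\le\mu$ means $\nu(A)\le\mu(A)$ for all Borel $A$. A set of probability measures on $\mathbb{R}^N$ is precompact under total variation if every sequence in it has a subsequence converging in total variation to some probability measure on $\mathbb{R}^N$ (not necessarily in the set), where the total variation distance is $\|\nu-\nu'\|_{TV}=2\sup_B|\nu(B)-\nu'(B)|$, supremum over Borel sets $B$. *)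

theory Defs
  imports "HOL-Analysis.Analysis" "HOL-Probability.Probability"
begin

definition prob_density :: "('a::euclidean_space \<Rightarrow> real) \<Rightarrow> bool" where
  "prob_density p \<longleftrightarrow>
     p \<in> borel_measurable borel \<and> (\<forall>x. 0 \<le> p x) \<and> has_bochner_integral lborel p 1"

definition density_measure :: "('a::euclidean_space \<Rightarrow> real) \<Rightarrow> 'a measure" where
  "density_measure p = density lborel (\<lambda>x. ennreal (p x))"

text \<open>Equicontinuity is pointwise: the modulus may depend on the point \<open>x\<close>, but not on the
  member \<open>f\<close> of the family.\<close>

definition equicontinuous :: "('a::metric_space \<Rightarrow> 'b::metric_space) set \<Rightarrow> bool" where
  "equicontinuous F \<longleftrightarrow>
     (\<forall>x. \<forall>e>0. \<exists>d>0. \<forall>f\<in>F. \<forall>y. dist y x < d \<longrightarrow> dist (f y) (f x) < e)"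

definition uniformly_bounded :: "('a \<Rightarrow> 'b::real_normed_vector) set \<Rightarrow> bool" where
  "uniformly_bounded F \<longleftrightarrow> (\<exists>C. \<forall>f\<in>F. \<forall>x. norm (f x) \<le> C)"

text \<open>Setwise domination on Borel sets; intended only for measures whose sigma-algebra is the
  Borel one.\<close>

definition setwise_le :: "'a::topological_space measure \<Rightarrow> 'a measure \<Rightarrow> bool" where
  "setwise_le \<nu> \<mu> \<longleftrightarrow> (\<forall>A\<in>sets borel. emeasure \<nu> A \<le> emeasure \<mu> A)"

text \<open>For finite measures the set under the supremum is bounded above, so the real-valued
  supremum is the genuine one.\<close>

definition tv_dist :: "'a::topological_space measure \<Rightarrow> 'a measure \<Rightarrow> real" where
  "tv_dist \<nu> \<nu>' = 2 * (SUP B\<in>sets borel. \<bar>measure \<nu> B - measure \<nu>' B\<bar>)"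

text \<open>Intended for sets of Borel probability measures. The limit need not lie in the set.\<close>

definition tv_precompact :: "'a::topological_space measure set \<Rightarrow> bool" where
  "tv_precompact S \<longleftrightarrow>
     (\<forall>X :: nat \<Rightarrow> 'a measure. (\<forall>n. X n \<in> S) \<longrightarrow>
        (\<exists>r Q. strict_mono r \<and> prob_space Q \<and> sets Q = sets borel \<and>
               (\<lambda>n. tv_dist (X (r n)) Q) \<longlonglongrightarrow> 0))"

end

theory Submission
  imports Defs "HOL-Complex_Analysis.Great_Picard"
begin

text \<open>
  Take a sequence of densities \<open>p\<^sub>n\<close> in the family whose measures lie below \<open>\<mu>\<close>. Being equicontinuous
  and uniformly bounded, it has a pointwise convergent subsequence: a diagonal argument gives convergence on a
  countable dense set, and equicontinuity carries it to every point
  (\<open>equicontinuous_pointwise_convergent_subsequence\<close>).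

  What has to be excluded is loss of mass in the limit. The domination by \<open>\<mu>\<close> does this in the form
  of an integrable majorant: if each \<open>f\<^sub>n\<close> is the density of a measure below \<open>\<mu>\<close>, then the measure
  with density \<open>sup\<^sub>n f\<^sub>n\<close> is still below \<open>\<mu>\<close>, because one may cut a set into the pieces on which one
  of the \<open>f\<^sub>n\<close> is largest. So \<open>sup\<^sub>n f\<^sub>n\<close> has integral at most \<open>\<mu>(\<real>\<^sup>N) < \<infinity>\<close>
  (\<open>nn_integral_SUP_le_of_density_le\<close>). Dominated convergence then yields convergence in \<open>L\<^sup>1\<close>; the
  limit again has integral \<open>1\<close>, and the \<open>L\<^sup>1\<close> distance of densities controls the total variation
  distance of the measures (\<open>tv_dist_density_measure_le\<close>).
\<close>

section \<open>Suprema of dominated densities\<close>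

text \<open>Cut each set along \<open>g \<le> f\<close>: on either piece the maximum is one of the two densities, and
  the bounds on the two pieces add up because \<open>\<mu>\<close> is additive.\<close>

lemma density_max_le:
  assumes [measurable]: "f \<in> borel_measurable M" "g \<in> borel_measurable M"
    and sets: "sets \<mu> = sets M"
    and f: "density M f \<le> \<mu>" and g: "density M g \<le> \<mu>"
  shows "density M (\<lambda>x. max (f x) (g x)) \<le> \<mu>"
proof -
  have f_le: "emeasure (density M f) A \<le> emeasure \<mu> A"
    and g_le: "emeasure (density M g) A \<le> emeasure \<mu> A" if "A \<in> sets M" for A
    using f g that sets by (auto simp: le_measure)
  have "emeasure (density M (\<lambda>x. max (f x) (g x))) A \<le> emeasure \<mu> A" if A[measurable]: "A \<in> sets M" for A
  proof -
    let ?h = "\<lambda>x. max (f x) (g x)"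
    define B where "B = {x \<in> space M. g x \<le> f x}"
    have B[measurable]: "B \<in> sets M"
      unfolding B_def by measurable
    have split: "emeasure N A = emeasure N (A \<inter> B) + emeasure N (A - B)" if "sets N = sets M" for N
      using that by (subst plus_emeasure) (auto intro!: arg_cong[where f = "emeasure N"])
    have "emeasure (density M ?h) (A \<inter> B) = emeasure (density M f) (A \<inter> B)"
      by (auto simp: emeasure_density B_def max_def indicator_def intro!: nn_integral_cong)
    moreover have "emeasure (density M ?h) (A - B) = emeasure (density M g) (A - B)"
      using sets.sets_into_space[OF A]
      by (auto simp: emeasure_density B_def max_def indicator_def intro!: nn_integral_cong)
    ultimately have "emeasure (density M ?h) A \<le> emeasure \<mu> (A \<inter> B) + emeasure \<mu> (A - B)"
      using f_le[of "A \<inter> B"] g_le[of "A - B"] by (simp add: split add_mono)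
    then show ?thesis
      using split[OF sets] by simp
  qed
  then show ?thesis
    using sets by (simp add: le_measure)
qed

text \<open>For finite \<open>\<mu>\<close> this makes \<open>sup\<^sub>n f\<^sub>n\<close> an integrable majorant of the sequence. Finite suprema are dominated by \<open>\<mu>\<close> by induction; they increase to
  the full supremum, so monotone convergence applies.\<close>

lemma nn_integral_SUP_le_of_density_le:
  fixes f :: "nat \<Rightarrow> 'a \<Rightarrow> ennreal"
  assumes f[measurable]: "\<And>n. f n \<in> borel_measurable M"
    and sets: "sets \<mu> = sets M"
    and le: "\<And>n. density M (f n) \<le> \<mu>"
  shows "(\<integral>\<^sup>+x. (SUP n. f n x) \<partial>M) \<le> emeasure \<mu> (space M)"
proof -
  define h where "h = rec_nat (f 0) (\<lambda>n h x. max (h x) (f (Suc n) x))"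
  have h_0: "h 0 = f 0" and h_Suc: "h (Suc n) = (\<lambda>x. max (h n x) (f (Suc n) x))" for n
    by (simp_all add: h_def)
  have h[measurable]: "h n \<in> borel_measurable M" for n
    by (induction n) (simp_all add: h_0 h_Suc)
  have h_le: "density M (h n) \<le> \<mu>" for n
    by (induction n) (simp_all add: h_0 h_Suc le density_max_le sets)
  have "incseq h"
    by (intro incseq_SucI) (simp add: h_Suc le_fun_def)
  have "f n x \<le> h n x" for n x
    by (cases n) (simp_all add: h_0 h_Suc)
  then have "(\<integral>\<^sup>+x. (SUP n. f n x) \<partial>M) \<le> (\<integral>\<^sup>+x. (SUP n. h n x) \<partial>M)"
    by (intro nn_integral_mono SUP_mono) auto
  also have "\<dots> = (SUP n. \<integral>\<^sup>+x. h n x \<partial>M)"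
    by (rule nn_integral_monotone_convergence_SUP[OF \<open>incseq h\<close> h])
  also have "\<dots> \<le> emeasure \<mu> (space M)"
  proof (rule SUP_least)
    fix n
    have "(\<integral>\<^sup>+x. h n x \<partial>M) = emeasure (density M (h n)) (space M)"
      by (simp add: emeasure_density cong: nn_integral_cong)
    also have "\<dots> \<le> emeasure \<mu> (space M)"
      using h_le[of n] sets by (simp add: le_measure)
    finally show "(\<integral>\<^sup>+x. h n x \<partial>M) \<le> emeasure \<mu> (space M)" .
  qed
  finally show ?thesis .
qed

section \<open>Pointwise convergent subsequences of equicontinuous families\<close>

text \<open>Equicontinuity lets the values at a nearby point of a countable dense set decide whether the
  values at \<open>x\<close> form a Cauchy sequence.\<close>

lemma equicontinuous_pointwise_convergent_subsequence:
  fixes f :: "nat \<Rightarrow> 'a::{metric_space, second_countable_topology} \<Rightarrow> 'b::{real_normed_vector, heine_borel}"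
  assumes equi: "equicontinuous F" and bdd: "uniformly_bounded F" and f: "\<And>n. f n \<in> F"
  obtains r g where "strict_mono (r :: nat \<Rightarrow> nat)" "\<And>x. (\<lambda>n. f (r n) x) \<longlonglongrightarrow> g x"
proof -
  obtain C where C: "\<And>p x. p \<in> F \<Longrightarrow> norm (p x) \<le> C"
    using bdd unfolding uniformly_bounded_def by blast
  obtain D :: "'a set" where "countable D" and D: "\<And>X. open X \<Longrightarrow> X \<noteq> {} \<Longrightarrow> \<exists>d\<in>D. d \<in> X"
    using countable_dense_setE by blast
  obtain r :: "nat \<Rightarrow> nat" where r: "strict_mono r"
    and conv: "\<And>d. d \<in> D \<Longrightarrow> \<exists>l. (\<lambda>n. f (r n) d) \<longlonglongrightarrow> l"
    using function_convergent_subsequence[OF \<open>countable D\<close>, of f C] C[OF f] by blast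
  have "\<exists>l. (\<lambda>n. f (r n) x) \<longlonglongrightarrow> l" for x
  proof -
    have "Cauchy (\<lambda>n. f (r n) x)"
    proof (rule metric_CauchyI)
      fix e :: real assume "0 < e"
      then obtain \<delta> where "0 < \<delta>"
        and \<delta>: "\<And>p y. p \<in> F \<Longrightarrow> dist y x < \<delta> \<Longrightarrow> dist (p y) (p x) < e / 3"
        using equi unfolding equicontinuous_def by (meson divide_pos_pos zero_less_numeral)
      obtain d where "d \<in> D" and d: "dist d x < \<delta>"
        using D[of "ball x \<delta>"] \<open>0 < \<delta>\<close> by (auto simp: dist_commute)
      have "Cauchy (\<lambda>n. f (r n) d)"
        using conv[OF \<open>d \<in> D\<close>] LIMSEQ_imp_Cauchy by blast
      then obtain N where N: "\<And>m n. m \<ge> N \<Longrightarrow> n \<ge> N \<Longrightarrow> dist (f (r m) d) (f (r n) d) < e / 3"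
        using \<open>0 < e\<close> unfolding Cauchy_def by (meson divide_pos_pos zero_less_numeral)
      have "dist (f (r m) x) (f (r n) x) < e" if "m \<ge> N" "n \<ge> N" for m n
      proof -
        have "dist (f (r m) x) (f (r n) x)
            \<le> dist (f (r m) d) (f (r m) x) + (dist (f (r m) d) (f (r n) d) + dist (f (r n) d) (f (r n) x))"
          using dist_triangle[of "f (r m) x" "f (r n) x" "f (r m) d"]
            dist_triangle[of "f (r m) d" "f (r n) x" "f (r n) d"] by (simp add: dist_commute)
        also have "\<dots> < e / 3 + (e / 3 + e / 3)"
          by (intro add_strict_mono \<delta> f d N that)
        finally show ?thesis by simp
      qed
      then show "\<exists>N. \<forall>m\<ge>N. \<forall>n\<ge>N. dist (f (r m) x) (f (r n) x) < e"
        by blast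
    qed
    then show ?thesis
      by (simp add: convergent_eq_Cauchy)
  qed
  then show thesis
    using that[OF r] by metis
qed

section \<open>Total variation distance of measures with densities\<close>

lemma emeasure_density_measure:
  "p \<in> borel_measurable borel \<Longrightarrow> A \<in> sets borel \<Longrightarrow>
    emeasure (density_measure p) A = (\<integral>\<^sup>+x. ennreal (p x) * indicator A x \<partial>lborel)"
  by (simp add: density_measure_def emeasure_density)

lemma measure_density_measure:
  fixes p :: "'a::euclidean_space \<Rightarrow> real"
  assumes "prob_density p" and [measurable]: "A \<in> sets borel"
  shows "measure (density_measure p) A = (\<integral>x. p x * indicator A x \<partial>lborel)"
proof -
  have [measurable]: "p \<in> borel_measurable borel" and "\<And>x. 0 \<le> p x"
    using assms by (auto simp: prob_density_def)
  then show ?thesis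
    unfolding measure_def
    by (subst integral_eq_nn_integral)
       (auto simp: emeasure_density_measure ennreal_mult' indicator_def
         intro!: arg_cong[where f = enn2real] nn_integral_cong)
qed

lemma prob_density_iff_nn_integral:
  fixes p :: "'a::euclidean_space \<Rightarrow> real"
  assumes "p \<in> borel_measurable borel" "\<And>x. 0 \<le> p x"
  shows "prob_density p \<longleftrightarrow> (\<integral>\<^sup>+x. ennreal (p x) \<partial>lborel) = 1"
proof
  assume "prob_density p"
  then have "integrable lborel p" "(\<integral>x. p x \<partial>lborel) = 1"
    by (simp_all add: prob_density_def has_bochner_integral_iff)
  then show "(\<integral>\<^sup>+x. ennreal (p x) \<partial>lborel) = 1"
    using assms(2) by (simp add: nn_integral_eq_integral)
next
  assume "(\<integral>\<^sup>+x. ennreal (p x) \<partial>lborel) = 1"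
  then have "has_bochner_integral lborel p 1"
    using assms by (intro has_bochner_integral_nn_integral) simp_all
  then show "prob_density p"
    using assms by (simp add: prob_density_def)
qed

text \<open>Over any single set, the integrals of \<open>p\<close> and \<open>q\<close> differ by at most the \<open>L\<^sup>1\<close> distance. The sharp
  statement, without the factor \<open>2\<close>, is an equality, but it would need the set where \<open>q < p\<close>; for
  convergence the constant is irrelevant.\<close>

lemma tv_dist_density_measure_le:
  fixes p q :: "'a::euclidean_space \<Rightarrow> real"
  assumes p: "prob_density p" and q: "prob_density q"
  shows "0 \<le> tv_dist (density_measure p) (density_measure q)"
    and "tv_dist (density_measure p) (density_measure q) \<le> 2 * (\<integral>x. \<bar>p x - q x\<bar> \<partial>lborel)"
proof -
  let ?D = "\<lambda>B. \<bar>measure (density_measure p) B - measure (density_measure q) B\<bar>"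
  have int[intro, simp]: "integrable lborel p" "integrable lborel q"
    using p q by (auto simp: prob_density_def has_bochner_integral_iff)
  have le: "?D B \<le> (\<integral>x. \<bar>p x - q x\<bar> \<partial>lborel)" if [measurable]: "B \<in> sets borel" for B
  proof -
    have intB: "integrable lborel (\<lambda>x. p x * indicator B x)" "integrable lborel (\<lambda>x. q x * indicator B x)"
      by (auto intro!: integrable_real_mult_indicator)
    have "?D B = \<bar>\<integral>x. p x * indicator B x - q x * indicator B x \<partial>lborel\<bar>"
      using intB by (simp add: measure_density_measure p q)
    also have "\<dots> \<le> (\<integral>x. \<bar>p x * indicator B x - q x * indicator B x\<bar> \<partial>lborel)"
      by (rule integral_abs_bound)
    also have "\<dots> \<le> (\<integral>x. \<bar>p x - q x\<bar> \<partial>lborel)"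
      using intB by (intro integral_mono) (auto simp: indicator_def)
    finally show ?thesis .
  qed
  have "bdd_above (?D ` sets borel)"
    using le by (auto intro!: bdd_aboveI)
  then have "?D {} \<le> (SUP B\<in>sets borel. ?D B)"
    by (intro cSUP_upper) auto
  then show "0 \<le> tv_dist (density_measure p) (density_measure q)"
    by (simp add: tv_dist_def)
  show "tv_dist (density_measure p) (density_measure q) \<le> 2 * (\<integral>x. \<bar>p x - q x\<bar> \<partial>lborel)"
    unfolding tv_dist_def using le by (auto intro!: cSUP_least simp: sets.empty_sets)
qed

section \<open>Passing to the limit under a dominating finite measure\<close>

text \<open>A dominating finite measure plays the part of tightness: it keeps mass from escaping to
  infinity. Here it enters as the integrable majorant \<open>h = sup\<^sub>n p\<^sub>n\<close> in dominated convergence, used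
  once for \<open>p\<^sub>n\<close> (the limit has integral \<open>1\<close>) and once for \<open>\<bar>p\<^sub>n - g\<bar> \<le> 2 h\<close> (convergence in \<open>L\<^sup>1\<close>).\<close>

lemma tv_convergence_of_dominated_densities:
  fixes p :: "nat \<Rightarrow> 'a::euclidean_space \<Rightarrow> real"
  assumes "finite_measure \<mu>" and sets: "sets \<mu> = sets borel"
    and p: "\<And>n. prob_density (p n)"
    and le: "\<And>n. setwise_le (density_measure (p n)) \<mu>"
    and lim: "\<And>x. (\<lambda>n. p n x) \<longlonglongrightarrow> g x"
  shows "prob_density g"
    and "(\<lambda>n. tv_dist (density_measure (p n)) (density_measure g)) \<longlonglongrightarrow> 0"
proof -
  have [measurable]: "p n \<in> borel_measurable borel" and p_nonneg: "0 \<le> p n x"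
    and p_int: "(\<integral>\<^sup>+x. ennreal (p n x) \<partial>lborel) = 1" for n x
    using p[of n] prob_density_iff_nn_integral[of "p n"] by (auto simp: prob_density_def)
  have [measurable]: "g \<in> borel_measurable borel"
    using lim by (rule borel_measurable_LIMSEQ_real) measurable
  have g_nonneg: "0 \<le> g x" for x
    using lim[of x] p_nonneg by (intro LIMSEQ_le_const) auto
  define h where "h x = (SUP n. ennreal (p n x))" for x
  have h[measurable]: "h \<in> borel_measurable borel"
    unfolding h_def by measurable
  have "(\<integral>\<^sup>+x. h x \<partial>lborel) \<le> emeasure \<mu> (space lborel)"
    unfolding h_def
  proof (rule nn_integral_SUP_le_of_density_le)
    show "density lborel (\<lambda>x. ennreal (p n x)) \<le> \<mu>" for n
      using le[of n] sets by (simp add: le_measure setwise_le_def density_measure_def)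
  qed (use sets in auto)
  also have "\<dots> < \<infinity>"
    using finite_measure.emeasure_finite[OF \<open>finite_measure \<mu>\<close>] by (simp add: top.not_eq_extremum)
  finally have h_fin: "(\<integral>\<^sup>+x. h x \<partial>lborel) < \<infinity>" .
  have p_le_h: "ennreal (p n x) \<le> h x" for n x
    unfolding h_def by (rule SUP_upper) simp
  have lim': "(\<lambda>n. ennreal (p n x)) \<longlonglongrightarrow> ennreal (g x)" for x
    by (rule tendsto_ennrealI[OF lim])
  have g_le_h: "ennreal (g x) \<le> h x" for x
    using lim'[of x] p_le_h by (intro LIMSEQ_le_const2) auto

  have "(\<lambda>n. \<integral>\<^sup>+x. ennreal (p n x) \<partial>lborel) \<longlonglongrightarrow> (\<integral>\<^sup>+x. ennreal (g x) \<partial>lborel)"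
    by (rule nn_integral_dominated_convergence[where w = h]) (auto simp: p_le_h lim' intro: h_fin[simplified])
  then have "(\<integral>\<^sup>+x. ennreal (g x) \<partial>lborel) = 1"
    by (simp add: p_int LIMSEQ_const_iff)
  then show g: "prob_density g"
    using prob_density_iff_nn_integral[of g] g_nonneg by simp

  have "(\<lambda>n. \<integral>\<^sup>+x. ennreal \<bar>p n x - g x\<bar> \<partial>lborel) \<longlonglongrightarrow> (\<integral>\<^sup>+x. 0 \<partial>(lborel :: 'a measure))"
  proof (rule nn_integral_dominated_convergence[where w = "\<lambda>x. h x + h x"])
    show "AE x in lborel. ennreal \<bar>p n x - g x\<bar> \<le> h x + h x" for n
    proof (rule AE_I2)
      fix x
      have "ennreal \<bar>p n x - g x\<bar> \<le> ennreal (p n x + g x)"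
        using p_nonneg[of n x] g_nonneg[of x] by (intro ennreal_leI) auto
      also have "\<dots> = ennreal (p n x) + ennreal (g x)"
        using p_nonneg[of n x] g_nonneg[of x] by simp
      also have "\<dots> \<le> h x + h x"
        by (intro add_mono p_le_h g_le_h)
      finally show "ennreal \<bar>p n x - g x\<bar> \<le> h x + h x" .
    qed
    show "(\<integral>\<^sup>+x. h x + h x \<partial>lborel) < \<infinity>"
      using h_fin by (simp add: nn_integral_add)
    show "AE x in lborel. (\<lambda>n. ennreal \<bar>p n x - g x\<bar>) \<longlonglongrightarrow> 0"
    proof (rule AE_I2)
      fix x
      have "(\<lambda>n. \<bar>p n x - g x\<bar>) \<longlonglongrightarrow> 0"
        using lim[of x] by (simp add: LIM_zero tendsto_rabs_zero)
      then show "(\<lambda>n. ennreal \<bar>p n x - g x\<bar>) \<longlonglongrightarrow> 0"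
        using tendsto_ennrealI by fastforce
    qed
  qed measurable
  then have "(\<lambda>n. enn2real (\<integral>\<^sup>+x. ennreal \<bar>p n x - g x\<bar> \<partial>lborel)) \<longlonglongrightarrow> enn2real 0"
    by (intro tendsto_enn2real) auto
  then have L1: "(\<lambda>n. \<integral>x. \<bar>p n x - g x\<bar> \<partial>lborel) \<longlonglongrightarrow> 0"
    by (subst integral_eq_nn_integral) auto
  show "(\<lambda>n. tv_dist (density_measure (p n)) (density_measure g)) \<longlonglongrightarrow> 0"
  proof (rule tendsto_sandwich[OF _ _ tendsto_const])
    show "(\<lambda>n. 2 * (\<integral>x. \<bar>p n x - g x\<bar> \<partial>lborel)) \<longlonglongrightarrow> 0"
      using tendsto_mult_left[OF L1, of 2] by simp
  qed (simp_all add: tv_dist_density_measure_le p g)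
qed

lemma prob_space_density_measure:
  fixes p :: "'a::euclidean_space \<Rightarrow> real"
  assumes "prob_density p"
  shows "prob_space (density_measure p)"
proof (rule prob_spaceI)
  have "p \<in> borel_measurable borel" "\<And>x. 0 \<le> p x"
    using assms by (simp_all add: prob_density_def)
  with assms show "emeasure (density_measure p) (space (density_measure p)) = 1"
    by (simp add: density_measure_def emeasure_density flip: prob_density_iff_nn_integral)
qed

theorem lemma4p3:
  fixes \<mu> :: "(real ^ 'n) measure"
    and F :: "(real ^ 'n \<Rightarrow> real) set"
  assumes "finite_measure \<mu>"
    and "sets \<mu> = sets borel"
    and "\<And>p. p \<in> F \<Longrightarrow> prob_density p"
    and "equicontinuous F"
    and "uniformly_bounded F"
  shows "tv_precompact {density_measure p | p. setwise_le (density_measure p) \<mu> \<and> p \<in> F}"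
  unfolding tv_precompact_def
proof (intro allI impI)
  fix X :: "nat \<Rightarrow> (real ^ 'n) measure"
  assume "\<forall>n. X n \<in> {density_measure p | p. setwise_le (density_measure p) \<mu> \<and> p \<in> F}"
  then have "\<forall>n. \<exists>p. X n = density_measure p \<and> setwise_le (density_measure p) \<mu> \<and> p \<in> F"
    by blast
  from choice[OF this] obtain p where X: "\<And>n. X n = density_measure (p n)"
    and le: "\<And>n. setwise_le (density_measure (p n)) \<mu>" and F: "\<And>n. p n \<in> F"
    by blast
  obtain r g where r: "strict_mono (r :: nat \<Rightarrow> nat)" and lim: "\<And>x. (\<lambda>n. p (r n) x) \<longlonglongrightarrow> g x"
    using equicontinuous_pointwise_convergent_subsequence[where f = p, OF assms(4,5) F] by blast
  note conv = tv_convergence_of_dominated_densities[where p = "\<lambda>n. p (r n)" and g = g,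
      OF assms(1,2) assms(3)[OF F] le lim]
  have "sets (density_measure g) = sets borel"
    by (simp add: density_measure_def)
  then show "\<exists>r Q. strict_mono r \<and> prob_space Q \<and> sets Q = sets borel \<and>
      (\<lambda>n. tv_dist (X (r n)) Q) \<longlonglongrightarrow> 0"
    using r prob_space_density_measure[OF conv(1)] conv(2) unfolding X by blast
qed

end
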